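(* Let $q=2^m$, where $m$ is a positive integer. Then $$f_4(X)=X^{1+q}+X^{1+q^2}+X^{2q^2+2}$$ is a permutation polynomial over $\mathbb{F}_{q^3}$ if and only if $m\not\equiv 2\pmod 3$.
   Context: A polynomial $f\in\mathbb{F}_{Q}[X]$ is a permutation polynomial over $\mathbb{F}_Q$ if $c\mapsto f(c)$ is a bijection of $\mathbb{F}_Q$. *)

theory Defs
  imports "HOL-Computational_Algebra.Polynomial" "HOL-Number_Theory.Cong"
begin

definition permutation_polynomial :: "'a::{field,finite} poly \<Rightarrow> bool"
  where "permutation_polynomial f \<longleftrightarrow> bij (\<lambda>c. poly f c)"

definition f4 :: "nat \<Rightarrow> 'a::field poly"
  where "f4 q = monom 1 (1 + q) + monom 1 (1 + q\<^sup>2) + monom 1 (2 * q\<^sup>2 + 2)"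

end

theory Submission
  imports Defs
begin

text \<open>
  For \<open>x \<in> F\<^bsub>q^3\<^esub>\<close> put \<open>u = x\<^bsup>1 + q^2\<^esup>\<close>. Since \<open>u\<^bsup>q\<^esup> = x\<^bsup>q + 1\<^esup>\<close>, we have
  \<open>f\<^sub>4(x) = u\<^sup>2 + u + u\<^bsup>q\<^esup>\<close>. The map \<open>x \<mapsto> u\<close> is a permutation, because \<open>x\<^sup>2 = u u\<^bsup>q\<^esup> / u\<^bsup>q^2\<^esup>\<close> and
  squaring is injective. So the question is whether the additive map \<open>L(u) = u\<^sup>2 + u + u\<^bsup>q\<^esup>\<close> has a
  nonzero kernel element. If \<open>u\<^bsup>q\<^esup> = u\<^sup>2 + u\<close>, then iterating gives
  \<open>u = u\<^bsup>q^3\<^esup> = u\<^sup>8 + u\<^sup>4 + u\<^sup>2 + u\<close>, so \<open>u\<^sup>4 = u\<^sup>2 + u = u\<^bsup>q\<^esup>\<close>, and \<open>u = 0\<close> or \<open>u\<^sup>3 = u + 1\<close>.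
  In the latter case \<open>u\<close> lies in \<open>F\<^sub>8 \<subseteq> F\<^bsub>q^3\<^esub>\<close>, where \<open>u\<^bsup>q\<^esup>\<close> depends only on \<open>m mod 3\<close>, and
  \<open>u\<^bsup>q\<^esup> = u\<^sup>4\<close> holds exactly for \<open>m \<equiv> 2 (mod 3)\<close>.
\<close>

text \<open>Multiplication by \<open>x\<close> permutes the nonzero elements, so their product
  absorbs one factor \<open>x\<close> per element.\<close>

lemma finite_field_power_card_minus_1:
  fixes x :: "'a::{field,finite}"
  assumes "x \<noteq> 0"
  shows "x ^ (card (UNIV :: 'a set) - 1) = 1"
proof -
  let ?S = "UNIV - {0 :: 'a}"
  have "bij_betw ((*) x) ?S ?S"
    by (rule bij_betw_byWitness[where f' = "\<lambda>y. y / x"]) (use assms in auto)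
  from prod.reindex_bij_betw[OF this, of id] have "(\<Prod>y\<in>?S. x * y) = \<Prod>?S"
    by simp
  then have "x ^ card ?S * \<Prod>?S = \<Prod>?S"
    by (simp add: prod.distrib)
  moreover have "\<Prod>?S \<noteq> 0"
    by simp
  ultimately show ?thesis
    by (simp add: card_Diff_subset)
qed

lemma finite_field_power_card:
  fixes x :: "'a::{field,finite}"
  shows "x ^ card (UNIV :: 'a set) = x"
proof (cases "x = 0")
  case False
  have "card (UNIV :: 'a set) > 0"
    by (simp add: finite_UNIV_card_ge_0)
  then have "x ^ card (UNIV :: 'a set) = x ^ (card (UNIV :: 'a set) - 1) * x"
    by (metis power_minus_mult)
  then show ?thesis
    using finite_field_power_card_minus_1[OF False] by simp
qed (simp add: finite_UNIV_card_ge_0 power_0_left)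

text \<open>Translation by 1 permutes the field; summing all elements shows that the cardinality
  vanishes in the field.\<close>

lemma CHAR_eq_prime_of_card:
  assumes "card (UNIV :: 'a::{field,finite} set) = p ^ n" "prime p"
  shows "CHAR('a) = p"
proof -
  have "prime CHAR('a)"
    by (simp add: prime_CHAR_semidom finite_imp_CHAR_pos)
  moreover have "CHAR('a) dvd p ^ n"
  proof -
    have "bij (\<lambda>x :: 'a. x + 1)"
      by (rule bij_betw_byWitness[where f' = "\<lambda>x. x - 1"]) auto
    from sum.reindex_bij_betw[OF this, of id]
    have "(\<Sum>x\<in>UNIV. x + 1) = (\<Sum>x\<in>UNIV. x :: 'a)"
      by simp
    then have "of_nat (card (UNIV :: 'a set)) = (0 :: 'a)"
      by (simp add: sum.distrib)
    then show ?thesis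
      using assms(1) by (simp only: of_nat_eq_0_iff_char_dvd)
  qed
  ultimately show ?thesis
    using assms(2) by (meson prime_dvd_power primes_dvd_imp_eq)
qed

text \<open>Every \<open>n\<close>-th power of a nonzero element is a seventh root of unity, and at
  most \<open>n\<close> of the \<open>7 * n\<close> nonzero elements have \<open>n\<close>-th power
  1.\<close>

lemma ex_seventh_root_of_unity:
  assumes "card (UNIV :: 'a::{field,finite} set) = 7 * n + 1" "n > 0"
  shows "\<exists>a :: 'a. a ^ 7 = 1 \<and> a \<noteq> 1"
proof -
  define p :: "'a poly" where "p = monom 1 n - 1"
  have "coeff p n = 1"
    using assms(2) by (simp add: p_def)
  then have "p \<noteq> 0"
    by auto
  moreover have "degree p \<le> n"
    unfolding p_def by (intro degree_diff_le degree_monom_le) simp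
  ultimately have *: "card {x. poly p x = 0} \<le> n"
    using card_poly_roots_bound order_trans by blast
  have "\<exists>x :: 'a. x \<noteq> 0 \<and> x ^ n \<noteq> 1"
  proof (rule ccontr)
    assume "\<not> ?thesis"
    then have "UNIV - {0} \<subseteq> {x. poly p x = 0}"
      by (auto simp: p_def poly_monom)
    from card_mono[OF _ this] * have "card (UNIV - {0::'a}) \<le> n"
      by simp
    then show False
      using assms by (simp add: card_Diff_subset)
  qed
  then obtain x :: 'a where x: "x \<noteq> 0" "x ^ n \<noteq> 1"
    by blast
  have "(x ^ n) ^ 7 = x ^ (card (UNIV :: 'a set) - 1)"
    by (simp add: assms(1) mult.commute flip: power_mult)
  then show ?thesis
    using x finite_field_power_card_minus_1 by metis
qed

lemma char_2_cubic_root: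
  fixes u :: "'a::field"
  assumes "CHAR('a) = 2" "u ^ 3 = u + 1"
  shows "u ^ 4 = u\<^sup>2 + u" "u ^ 7 = 1"
proof -
  have two: "2 = (0 :: 'a)"
    using of_nat_CHAR[where 'a='a] assms(1) by simp
  show 4: "u ^ 4 = u\<^sup>2 + u"
    using assms(2) by algebra
  have "u ^ 7 = u ^ 4 * u ^ 3"
    by (simp flip: power_add)
  also have "\<dots> = 2 * (u\<^sup>2 + u) + 1"
    unfolding 4 using assms(2) by algebra
  also have "\<dots> = 1"
    by (simp add: two)
  finally show "u ^ 7 = 1" .
qed

text \<open>Squaring three times fixes \<open>u\<close>, because \<open>u ^ 7 = 1\<close>.\<close>

lemma power_two_power_cubic_root:
  fixes u :: "'a::field"
  assumes "CHAR('a) = 2" "u ^ 3 = u + 1"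
  shows "u ^ (2 ^ m) = u ^ (2 ^ (m mod 3))"
proof -
  have "u ^ 8 = u ^ 7 * u"
    by (simp flip: power_Suc2)
  then have "u ^ 8 = u"
    using char_2_cubic_root[OF assms] by simp
  then have *: "u ^ (8 ^ k) = u" for k
    by (induction k) (simp_all add: power_mult)
  have "(2 :: nat) ^ m = 2 ^ (3 * (m div 3) + m mod 3)"
    by simp
  also have "\<dots> = 8 ^ (m div 3) * 2 ^ (m mod 3)"
    unfolding power_add power_mult by simp
  finally show ?thesis
    by (simp add: power_mult *)
qed

lemma ex_cubic_root:
  assumes "card (UNIV :: 'a::{field,finite} set) = 8 ^ m" "m > 0" "CHAR('a) = 2"
  shows "\<exists>u :: 'a. u ^ 3 = u + 1"
proof -
  have two: "2 = (0 :: 'a)"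
    using of_nat_CHAR[where 'a='a] assms(3) by simp
  have "[8 ^ m = 1 ^ m] (mod 7 :: nat)"
    by (rule cong_pow) (simp add: cong_def)
  then have "(8 ^ m :: nat) mod 7 = 1"
    by (simp add: cong_def)
  then obtain n where n: "(8 ^ m :: nat) = 7 * n + 1"
    by (metis mult_div_mod_eq)
  have "(8 :: nat) \<le> 8 ^ m"
    using assms(2) by (simp add: self_le_power)
  then have "n > 0"
    using n by simp
  then obtain a :: 'a where a: "a ^ 7 = 1" "a \<noteq> 1"
    using ex_seventh_root_of_unity n assms(1) by metis
  \<comment> \<open>This is the factorization of \<open>X^7 - 1\<close> over the field with two
    elements, lifted to the integers; the even correction vanishes in characteristic 2.\<close>
  have "(a - 1) * ((a ^ 3 - a - 1) * (a ^ 3 - a\<^sup>2 - 1)) =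
      a ^ 7 - 1 - 2 * ((a - 1) * (a ^ 5 + a ^ 4 + a ^ 3))"
    by algebra
  also have "\<dots> = 0"
    by (simp add: a two)
  finally have "(a - 1) * ((a ^ 3 - a - 1) * (a ^ 3 - a\<^sup>2 - 1)) = 0" .
  then consider "a ^ 3 - a - 1 = 0" | "a ^ 3 - a\<^sup>2 - 1 = 0"
    using a(2) by auto
  then show ?thesis
  proof cases
    case 1
    then have "a ^ 3 = a + 1"
      by algebra
    then show ?thesis ..
  next
    case 2
    \<comment> \<open>The two cubic factors of \<open>X\<^sup>6 + X\<^sup>5 + \<dots> + 1\<close> are reciprocal, and \<open>a\<^sup>6\<close> is the inverse of \<open>a\<close>.\<close>
    have "(a ^ 6) ^ 3 = a ^ 4"
      using a(1) by algebra
    \<comment> \<open>Obtained by squaring \<open>a ^ 3 = a\<^sup>2 + 1\<close>.\<close>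
    also have "a ^ 4 = a ^ 6 + 1 - 2 * (a\<^sup>2 + 1)"
      using 2 by algebra
    finally have "(a ^ 6) ^ 3 = a ^ 6 + 1"
      by (simp add: two)
    then show ?thesis ..
  qed
qed

theorem theorem3p4:
  fixes m q :: nat
  assumes "m > 0"
    and "q = 2 ^ m"
    and "card (UNIV :: 'a::{field,finite} set) = q ^ 3"
  shows "permutation_polynomial (f4 q :: 'a poly) \<longleftrightarrow> \<not> [m = 2] (mod 3)"
proof -
  have char: "CHAR('a) = 2"
    by (rule CHAR_eq_prime_of_card[of _ "m * 3"]) (simp_all add: assms power_mult)
  have two: "2 = (0 :: 'a)"
    using of_nat_CHAR[where 'a='a] char by simp
  have add_self: "x + x = 0" for x :: 'a
    by (simp add: two flip: mult_2)
  have frob_add: "(x + y) ^ q = x ^ q + y ^ q" for x y :: 'a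
    by (rule freshmans_dream'[of _ m]) (simp_all add: char assms)
  have frob3: "((x ^ q) ^ q) ^ q = x" for x :: 'a
    using finite_field_power_card[of x]
    by (simp add: assms(3) power3_eq_cube mult.assoc flip: power_mult)
  have eq0: "x = 0" if "x ^ k = 0" for x :: 'a and k
    using that by simp
  have sq_inj: "x = y" if "x\<^sup>2 = y\<^sup>2" for x y :: 'a
  proof -
    have "(x - y)\<^sup>2 = 2 * (y\<^sup>2 - x * y)"
      using that by algebra
    then show ?thesis
      by (simp add: two)
  qed
  have q0: "q > 0"
    by (simp add: assms)

  define N where "N = (\<lambda>x :: 'a. x * (x ^ q) ^ q)"
  define L where "L = (\<lambda>u :: 'a. u\<^sup>2 + u + u ^ q)"
  have N_q: "N x ^ q = x ^ q * x" for x
    by (simp add: N_def power_mult_distrib frob3)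
  have poly: "poly (f4 q) x = L (N x)" for x :: 'a
  proof -
    have "x ^ q\<^sup>2 = (x ^ q) ^ q"
      by (simp add: power2_eq_square flip: power_mult)
    then show ?thesis
      unfolding L_def N_q
      by (simp add: f4_def poly_monom N_def power_add power_mult power_mult_distrib
        power2_eq_square[of q] power2_eq_square[of x] mult_ac flip: power_mult)
  qed

  have "inj N"
  proof (rule injI)
    fix x y assume eq: "N x = N y"
    have *: "N z * N z ^ q = z\<^sup>2 * (N z ^ q) ^ q" for z
      unfolding N_q by (simp add: N_def power_mult_distrib power2_eq_square mult_ac)
    have N0: "z = 0" if "N z = 0" for z
      using that eq0 by (auto simp: N_def)
    show "x = y"
    proof (cases "N x = 0")
      case True
      then show ?thesis
        using N0 eq by metis
    next
      case False
      then have "(N x ^ q) ^ q \<noteq> 0"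
        by simp
      moreover have "x\<^sup>2 * (N x ^ q) ^ q = y\<^sup>2 * (N x ^ q) ^ q"
        using * eq by metis
      ultimately have "x\<^sup>2 = y\<^sup>2"
        by (metis mult_right_cancel)
      then show ?thesis
        by (rule sq_inj)
    qed
  qed
  then have bij_N: "bij N"
    by (simp add: bij_def finite_UNIV_inj_surj)
  have "permutation_polynomial (f4 q :: 'a poly) \<longleftrightarrow> bij (L \<circ> N)"
    by (simp add: permutation_polynomial_def poly comp_def)
  also have "\<dots> \<longleftrightarrow> bij L"
    using bij_betw_comp_iff[OF bij_N] by blast
  also have "\<dots> \<longleftrightarrow> inj L"
    by (auto simp: bij_def finite_UNIV_inj_surj)
  also have "\<dots> \<longleftrightarrow> (\<forall>u. L u = 0 \<longrightarrow> u = 0)"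
  proof
    have "L 0 = 0"
      using q0 by (simp add: L_def)
    then show "\<forall>u. L u = 0 \<longrightarrow> u = 0" if "inj L"
      using that by (metis injD)
    show "inj L" if ker: "\<forall>u. L u = 0 \<longrightarrow> u = 0"
    proof (rule injI)
      fix x y assume "L x = L y"
      \<comment> \<open>Additivity of \<open>L\<close> up to an even term; since
        \<open>-y = y\<close>, a trivial kernel then gives injectivity.\<close>
      moreover have "L (x + y) = L x + L y + 2 * (x * y)"
        unfolding L_def frob_add by algebra
      ultimately have "x + y = 0"
        using ker add_self by (simp add: two)
      then show "x = y"
        using add_self[of y] by (metis add_right_cancel)
    qed
  qed
  also have "\<dots> \<longleftrightarrow> \<not> [m = 2] (mod 3)"
  proof
    assume ker: "\<forall>u. L u = 0 \<longrightarrow> u = 0"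
    show "\<not> [m = 2] (mod 3)"
    proof
      assume "[m = 2] (mod 3)"
      then have "m mod 3 = 2"
        by (simp add: cong_def)
      have "card (UNIV :: 'a set) = 8 ^ m"
        using assms power_mult[of "2 :: nat" 3 m] by (simp add: mult.commute flip: power_mult)
      then obtain u :: 'a where u: "u ^ 3 = u + 1"
        using ex_cubic_root char assms(1) by blast
      note u' = char_2_cubic_root[OF char u]
      have "u ^ q = u ^ 4"
        using power_two_power_cubic_root[OF char u, of m] assms(2) \<open>m mod 3 = 2\<close> by simp
      then have "L u = 0"
        unfolding L_def u'(1) by (simp add: add_self)
      with ker u q0 show False
        by auto
    qed
  next
    assume m: "\<not> [m = 2] (mod 3)"
    show "\<forall>u. L u = 0 \<longrightarrow> u = 0"
    proof (intro allI impI, rule ccontr)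
      fix u assume L: "L u = 0" and u0: "u \<noteq> 0"
      have uq: "u ^ q = u\<^sup>2 + u"
        using L add_self[of "u\<^sup>2 + u"] unfolding L_def by (metis add_left_cancel)
      have pow_q: "(x ^ k) ^ q = (x ^ q) ^ k" for x :: 'a and k
        by (simp add: mult.commute flip: power_mult)
      have "(u ^ q) ^ q = u ^ 4 + u + 2 * (u ^ 3 + u\<^sup>2)"
        unfolding uq frob_add pow_q by algebra
      then have uqq: "(u ^ q) ^ q = u ^ 4 + u"
        by (simp add: two)
      have "u = (u\<^sup>2 + u) ^ 4 + (u\<^sup>2 + u)"
        using frob3[of u] unfolding uqq unfolding frob_add pow_q unfolding uq by (rule sym)
      \<comment> \<open>Expanding leaves \<open>u^8 = u^4 + u^2\<close> modulo 2, an equation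
        between squares; the subtracted term collects the even coefficients and sign
        changes.\<close>
      then have "(u ^ 4)\<^sup>2 = (u\<^sup>2 + u)\<^sup>2 - 2 * (2 * u ^ 7 + 3 * u ^ 6 + 2 * u ^ 5 + u ^ 4 + u ^ 3 + u\<^sup>2)"
        by algebra
      then have "(u ^ 4)\<^sup>2 = (u\<^sup>2 + u)\<^sup>2"
        by (simp add: two)
      then have "u ^ 4 = u\<^sup>2 + u"
        by (rule sq_inj)
      then have "u * (u ^ 3) = u * (u + 1)"
        by algebra
      then have u3: "u ^ 3 = u + 1"
        using u0 by simp
      have "u ^ q = u ^ (2 ^ (m mod 3))"
        using power_two_power_cubic_root[OF char u3, of m] assms(2) by simp
      moreover have "m mod 3 = 0 \<or> m mod 3 = 1"
        using m unfolding cong_def by auto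
      \<comment> \<open>The residues 0 and 1 give \<open>u ^ q = u\<close> and
        \<open>u ^ q = u\<^sup>2\<close>; either one forces \<open>u = 0\<close>.\<close>
      ultimately have "u\<^sup>2 + u = u \<or> u\<^sup>2 + u = u\<^sup>2"
        unfolding uq by auto
      then show False
        using u0 by auto
    qed
  qed
  finally show ?thesis .
qed

end
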